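(* Let $p<q<r$ be primes, let $a\in\mathbb{N}$, and let $L=\operatorname{lcm}(p-1,q-1,r-1)$. Assume that $qr\equiv 1 \pmod p$. Then the following statements hold. (i) If $\gcd(a,pqr)=1$, then $a^{L}\equiv 1 \pmod{pqr}$. (ii) If $\gcd(a,pqr)=r$, then $a^{L}\equiv rq(1-a\,a_q)+a\,a_q \pmod{pqr}$. (iii) If $\gcd(a,pqr)=q$, then $a^{L}\equiv r(1-qr)\bar\beta+1 \pmod{pqr}$, where $\bar\beta\in\{0,1,\dots,q-1\}$ satisfies $r\bar\beta+1\equiv 0 \pmod q$. (iv) If $\gcd(a,pqr)=p$, then $a^{L}\equiv 1-rq \pmod{pqr}$. (v) $a_1^{L}+a_2^{L}+a_3^{L}\equiv 2 \pmod{pqr}$ for all $a_1,a_2,a_3\in\mathbb{N}$ satisfying $\gcd(a_1,pqr)=p$, $\gcd(a_2,pqr)=q$ and $\gcd(a_3,pqr)=r$.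
   Context: $\mathbb{N}$ denotes the set of positive integers. For a prime $q$ and $m\in\mathbb{N}$ not divisible by $q$, $m_q\in\{1,2,\dots,q-1\}$ denotes the multiplicative inverse of $m$ modulo $q$, i.e. the unique element of $\{1,\dots,q-1\}$ with $m\,m_q\equiv 1 \pmod q$. In (ii), $a_q$ is this inverse of $a$ modulo $q$. In (v), $a_1,a_2,a_3$ are simply indexed positive integers (the subscripts do not denote inverses). Congruences are between integers. *)

theory Defs
  imports "HOL-Number_Theory.Number_Theory" "HOL-Number_Theory.Modular_Inverse"
begin

text \<open>
  The inverse \<open>m\<^sub>q \<in> {1, \<dots>, q - 1}\<close> of \<open>m\<close> modulo a prime \<open>q\<close> not dividing \<open>m\<close> is
  \<^term>\<open>modular_inverse (int q) (int m)\<close>: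
\<close>

lemma modular_inverse_prime_iff:
  fixes q m :: nat and x :: int
  assumes "prime q" "\<not> q dvd m"
  shows "x = modular_inverse (int q) (int m) \<longleftrightarrow>
    x \<in> {1..int q - 1} \<and> [int m * x = 1] (mod int q)"
proof
  have q: "int q > 1"
    using prime_gt_1_nat[OF assms(1)] by simp
  have cop: "coprime (int m) (int q)"
    using prime_imp_coprime[OF assms] by (simp add: coprime_commute)
  assume x: "x = modular_inverse (int q) (int m)"
  have c: "[int m * x = 1] (mod int q)"
    unfolding x by (rule cong_modular_inverse1[OF cop])
  moreover have "0 \<le> x" "x < int q"
    unfolding x using q by (auto intro: modular_inverse_int_nonneg modular_inverse_int_less)
  moreover have "x \<noteq> 0"
    using c q by (auto simp: cong_def)
  ultimately show "x \<in> {1..int q - 1} \<and> [int m * x = 1] (mod int q)"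
    by auto
next
  assume "x \<in> {1..int q - 1} \<and> [int m * x = 1] (mod int q)"
  then have "modular_inverse (int q) (int m) = x"
    by (intro modular_inverse_int_eqI) auto
  then show "x = modular_inverse (int q) (int m)" ..
qed

end

(* By Fermat, a ^ L is 0 or 1 modulo each of p, q, r, according to whether that prime divides a,
   i.e. divides gcd a (p * q * r). By the Chinese remainder theorem it remains to compare the
   right-hand sides with these values modulo each prime; modulo p the hypothesis makes the
   factor 1 - q * r vanish. *)
theory Submission
  imports Defs
begin

text \<open>Fermat's little theorem, raised to the power \<open>L div (s - 1)\<close>, settles the
  coprime case. In the other case \<open>L > 0\<close> matters, since \<open>a ^ 0\<close> would be
  1.\<close>

lemma cong_pow_prime:
  fixes s a L :: nat
  assumes "prime s" and "(s - 1) dvd L" and "L > 0"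
  shows "[int a ^ L = (if s dvd a then 0 else 1)] (mod int s)"
proof (cases "s dvd a")
  case True
  with \<open>L > 0\<close> have "s dvd a ^ L"
    by (meson dvd_power dvd_trans)
  with True show ?thesis
    by (simp add: cong_0_iff flip: of_nat_power)
next
  case False
  obtain k where k: "L = (s - 1) * k"
    using assms(2) by auto
  have "[(a ^ (s - 1)) ^ k = 1 ^ k] (mod s)"
    by (intro cong_pow fermat_theorem assms False)
  then have "[a ^ L = 1] (mod s)"
    by (simp add: k power_mult)
  with False show ?thesis
    using cong_int_iff[of "a ^ L" 1 s] by simp
qed

lemma cong_mod_three_primes:
  fixes p q r :: nat and x y :: int
  assumes "prime p" "prime q" "prime r" "p \<noteq> q" "p \<noteq> r" "q \<noteq> r"
    and "[x = y] (mod int p)" "[x = y] (mod int q)" "[x = y] (mod int r)"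
  shows "[x = y] (mod int (p * q * r))"
proof -
  have "coprime (int p) (int q)" "coprime (int p * int q) (int r)"
    using assms(1-6) by (simp_all add: primes_coprime)
  then show ?thesis
    using assms(7-9) by (simp add: coprime_cong_mult)
qed

theorem theorem5:
  fixes p q r a L :: nat
  assumes "prime p" and "prime q" and "prime r"
    and "p < q" and "q < r"
    and "a > 0"
    and "L = lcm (p - 1) (lcm (q - 1) (r - 1))"
    and "[int q * int r = 1] (mod int p)"
  shows
    "(gcd a (p * q * r) = 1 \<longrightarrow>
        [int a ^ L = 1] (mod int (p * q * r))) \<and>
     (gcd a (p * q * r) = r \<longrightarrow>
        [int a ^ L = int r * int q * (1 - int a * modular_inverse (int q) (int a))
                       + int a * modular_inverse (int q) (int a)] (mod int (p * q * r))) \<and>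
     (gcd a (p * q * r) = q \<longrightarrow>
        (\<exists>!\<beta>. \<beta> \<in> {0..int q - 1} \<and> [int r * \<beta> + 1 = 0] (mod int q)) \<and>
        (\<forall>\<beta>. \<beta> \<in> {0..int q - 1} \<and> [int r * \<beta> + 1 = 0] (mod int q) \<longrightarrow>
             [int a ^ L = int r * (1 - int q * int r) * \<beta> + 1] (mod int (p * q * r)))) \<and>
     (gcd a (p * q * r) = p \<longrightarrow>
        [int a ^ L = 1 - int r * int q] (mod int (p * q * r))) \<and>
     (\<forall>a\<^sub>1 a\<^sub>2 a\<^sub>3 :: nat. a\<^sub>1 > 0 \<and> a\<^sub>2 > 0 \<and> a\<^sub>3 > 0 \<and>
        gcd a\<^sub>1 (p * q * r) = p \<and> gcd a\<^sub>2 (p * q * r) = q \<and> gcd a\<^sub>3 (p * q * r) = r \<longrightarrow>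
        [int a\<^sub>1 ^ L + int a\<^sub>2 ^ L + int a\<^sub>3 ^ L = 2] (mod int (p * q * r)))"
proof -
  \<comment> \<open>\<open>e g s\<close> is the expected residue modulo \<open>s\<close> of
    \<open>b ^ L\<close> for every \<open>b\<close> with \<open>gcd b (p * q * r) = g\<close>; the
    residue depends on \<open>b\<close> only through this gcd.\<close>
  define e where "e g s = (if s dvd g then 0 else 1 :: int)" for g s :: nat
  have neq: "p \<noteq> q" "p \<noteq> r" "q \<noteq> r"
    using assms(4,5) by auto
  have ndvd: "\<not> p dvd q" "\<not> p dvd r" "\<not> q dvd p" "\<not> q dvd r" "\<not> r dvd p" "\<not> r dvd q"
    using neq assms(1-3) by (auto dest: primes_dvd_imp_eq)
  have "L > 0"
    using assms(1-3)[THEN prime_gt_1_nat] by (simp add: assms(7) lcm_pos_nat)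
  \<comment> \<open>As \<open>s\<close> divides \<open>p * q * r\<close>, it divides
    \<open>b\<close> iff it divides the gcd, so Fermat's case distinction can be read off from the
    gcd alone.\<close>
  have pow: "[int b ^ L = e (gcd b (p * q * r)) s] (mod int s)"
    if "s \<in> {p, q, r}" for b s :: nat
  proof -
    have "prime s" "s dvd p * q * r"
      using that assms(1-3) by auto
    moreover have "(s - 1) dvd L"
      using that unfolding assms(7) by (metis dvd_lcm1 dvd_lcm2 dvd_trans empty_iff insert_iff)
    ultimately show ?thesis
      using cong_pow_prime[of s L b] \<open>L > 0\<close> by (simp add: e_def)
  qed
  have crt: "[x = y] (mod int (p * q * r))"
    if "[x = y] (mod int p)" "[x = y] (mod int q)" "[x = y] (mod int r)" for x y
    using cong_mod_three_primes that assms(1-3) neq by blast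
  \<comment> \<open>This removes the power: for each of the first four claims only the right-hand
    side \<open>y\<close> has to be evaluated modulo the three primes.\<close>
  have crt_pow: "[int b ^ L = y] (mod int (p * q * r))"
    if "gcd b (p * q * r) = g" "[y = e g p] (mod int p)" "[y = e g q] (mod int q)"
      "[y = e g r] (mod int r)" for b g y
    using pow[of p b] pow[of q b] pow[of r b] that(2-4)[THEN cong_sym] unfolding that(1)
    by (intro crt) (blast intro: cong_trans)+
  have pdvd: "int p dvd int q * int r - 1"
    using assms(8) by (simp add: cong_iff_dvd_diff)
  have prime_not_unit: "p \<noteq> 1" "q \<noteq> 1" "r \<noteq> 1"
    using assms(1-3) by auto

  have i: "[int a ^ L = 1] (mod int (p * q * r))" if "gcd a (p * q * r) = 1"
    using that prime_not_unit by (intro crt_pow) (auto simp: e_def)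

  have ii: "[int a ^ L = int r * int q * (1 - int a * modular_inverse (int q) (int a))
      + int a * modular_inverse (int q) (int a)] (mod int (p * q * r))"
    if g: "gcd a (p * q * r) = r"
  proof (rule crt_pow[OF g])
    let ?c = "int a * modular_inverse (int q) (int a)"
    \<comment> \<open>Otherwise \<open>q\<close> would divide the gcd, which is \<open>r\<close>.
      Hence the modular inverse is a genuine one and \<open>?c\<close> is 1 modulo
      \<open>q\<close>.\<close>
    have "\<not> q dvd a"
      using g ndvd(4) by (metis dvd_triv_right dvd_mult2 gcd_greatest)
    then have "coprime (int a) (int q)"
      using prime_imp_coprime[OF assms(2)] by (simp add: coprime_commute)
    then have "[?c = 1] (mod int q)"
      by (rule cong_modular_inverse1)
    then have "int q dvd ?c - 1"
      by (simp add: cong_iff_dvd_diff)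
    moreover have "int r * int q * (1 - ?c) + ?c - 1 = int q * (int r * (1 - ?c)) + (?c - 1)"
      by (simp add: algebra_simps)
    ultimately show "[int r * int q * (1 - ?c) + ?c = e r q] (mod int q)"
      using ndvd(4) by (simp only: e_def cong_iff_dvd_diff if_False) simp
    \<comment> \<open>Modulo \<open>p\<close>, the difference from the target 1 contains the factor
      \<open>q * r - 1\<close>, which the hypothesis makes divisible by \<open>p\<close>.\<close>
    have "int r * int q * (1 - ?c) + ?c - 1 = (int q * int r - 1) * (1 - ?c)"
      by (simp add: algebra_simps)
    then show "[int r * int q * (1 - ?c) + ?c = e r p] (mod int p)"
      using ndvd(2) pdvd by (simp add: e_def cong_iff_dvd_diff)
    \<comment> \<open>Modulo \<open>r\<close> both summands vanish: the first has the factor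
      \<open>r\<close>, the second the factor \<open>a\<close>.\<close>
    have "int r dvd int a"
      using g by (metis gcd_dvd1 int_dvd_int_iff)
    then show "[int r * int q * (1 - ?c) + ?c = e r r] (mod int r)"
      by (simp add: e_def cong_0_iff mult.assoc)
  qed

  have iii: "[int a ^ L = int r * (1 - int q * int r) * \<beta> + 1] (mod int (p * q * r))"
    if g: "gcd a (p * q * r) = q" and \<beta>: "[int r * \<beta> + 1 = 0] (mod int q)" for \<beta>
  proof (rule crt_pow[OF g])
    have "int r * (1 - int q * int r) * \<beta> + 1 - 1 = (int q * int r - 1) * (- int r * \<beta>)"
      by (simp add: algebra_simps)
    then show "[int r * (1 - int q * int r) * \<beta> + 1 = e q p] (mod int p)"
      using ndvd(1) pdvd by (simp only: e_def cong_iff_dvd_diff if_False dvd_mult2)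
    \<comment> \<open>Modulo \<open>q\<close> the factor \<open>1 - q * r\<close> may be replaced by
      1, which leaves the defining congruence of \<beta>.\<close>
    have "int r * (1 - int q * int r) * \<beta> + 1
        = (int r * \<beta> + 1) - int q * (int r * int r * \<beta>)"
      by (simp add: algebra_simps)
    then show "[int r * (1 - int q * int r) * \<beta> + 1 = e q q] (mod int q)"
      using \<beta> by (simp only: e_def cong_0_iff dvd_refl if_True dvd_diff dvd_triv_left)
    show "[int r * (1 - int q * int r) * \<beta> + 1 = e q r] (mod int r)"
      using ndvd(6) by (simp add: e_def cong_iff_dvd_diff mult.assoc)
  qed

  have ex1: "\<exists>!\<beta>. \<beta> \<in> {0..int q - 1} \<and> [int r * \<beta> + 1 = 0] (mod int q)"
  proof -
    have cop: "coprime (int r) (int q)"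
      using assms(2,3) neq by (simp add: primes_coprime)
    have q: "int q > 0"
      using assms(2) by (simp add: prime_gt_0_nat)
    \<comment> \<open>The witness is the negated inverse of \<open>r\<close> modulo
      \<open>q\<close>, reduced into the range from 0 to \<open>q - 1\<close>.\<close>
    obtain x where "[int r * x = 1] (mod int q)"
      using cong_solve_coprime_int[OF cop] by blast
    then have "int q dvd int r * x - 1"
      by (simp add: cong_iff_dvd_diff)
    then have "[int r * (- x) + 1 = 0] (mod int q)"
      using dvd_minus_iff[of "int q" "int r * x - 1"] by (simp add: cong_0_iff)
    then have "[int r * (- x mod int q) + 1 = 0] (mod int q)"
      unfolding cong_def by (metis mod_add_left_eq mod_mult_right_eq)
    moreover have "\<beta> = \<gamma>"
      if "\<beta> \<in> {0..int q - 1}" "[int r * \<beta> + 1 = 0] (mod int q)"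
        "\<gamma> \<in> {0..int q - 1}" "[int r * \<gamma> + 1 = 0] (mod int q)" for \<beta> \<gamma>
    proof -
      \<comment> \<open>Uniqueness: cancel the summand 1, then the unit \<open>r\<close>; congruent
        numbers in the range from 0 to \<open>q - 1\<close> are equal.\<close>
      have "[int r * \<beta> = int r * \<gamma>] (mod int q)"
        using that(2,4) by (metis cong_add_rcancel cong_sym cong_trans)
      then have "[\<beta> = \<gamma>] (mod int q)"
        using cop by (simp add: cong_mult_lcancel)
      then show ?thesis
        using that(1,3) by (simp add: cong_def)
    qed
    ultimately show ?thesis
      using q by (intro ex1I[of _ "- x mod int q"]) auto
  qed

  have iv: "[int a ^ L = 1 - int r * int q] (mod int (p * q * r))"
    if g: "gcd a (p * q * r) = p"
  proof (rule crt_pow[OF g])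
    have "1 - int r * int q = - (int q * int r - 1)"
      by simp
    then show "[1 - int r * int q = e p p] (mod int p)"
      using pdvd by (simp only: e_def cong_0_iff dvd_refl if_True dvd_minus_iff)
  \<comment> \<open>Modulo \<open>q\<close> and modulo \<open>r\<close> the product
    \<open>r * q\<close> vanishes, which leaves the required 1.\<close>
  qed (use ndvd in \<open>simp_all add: e_def cong_iff_dvd_diff\<close>)

  have v: "[int a1 ^ L + int a2 ^ L + int a3 ^ L = 2] (mod int (p * q * r))"
    if "gcd a1 (p * q * r) = p" "gcd a2 (p * q * r) = q" "gcd a3 (p * q * r) = r" for a1 a2 a3
  proof -
    have "[int a1 ^ L + int a2 ^ L + int a3 ^ L = 2] (mod int s)" if "s \<in> {p, q, r}" for s
    proof -
      have "[int a1 ^ L + int a2 ^ L + int a3 ^ L = e p s + e q s + e r s] (mod int s)"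
        using pow[OF that, of a1] pow[OF that, of a2] pow[OF that, of a3]
        by (intro cong_add) (simp_all add: \<open>gcd a1 _ = _\<close> \<open>gcd a2 _ = _\<close> \<open>gcd a3 _ = _\<close>)
      \<comment> \<open>Each \<open>s\<close> divides exactly one of the three gcds
        \<open>p\<close>, \<open>q\<close>, \<open>r\<close>, so one summand is 0 and the other two
        are 1.\<close>
      moreover have "e p s + e q s + e r s = 2"
        using that ndvd by (auto simp: e_def)
      ultimately show ?thesis
        by simp
    qed
    then show ?thesis
      by (intro crt) simp_all
  qed

  show ?thesis
    using i ii iii ex1 iv v by blast
qed

end
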